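(* MinAvgSTC with a constant number $m$ of machines and a constant number $K$ of scenarios (and arbitrary non-negative job weights) can be solved to optimality in polynomial time.
   Context: An instance consists of jobs $[n]$, machines $[m]$, non-negative job weights $w_1\ge\dots\ge w_n$, and scenarios $S_1,\dots,S_K\subseteq[n]$. A solution is an assignment $\varphi:[n]\to[m]$; write $J_i=\varphi^{-1}(i)$. The cost of $\varphi$ in scenario $k$ is $G(\varphi,k)=\sum_{i=1}^m\sum_{j\in J_i\cap S_k} w_j\cdot|\{j'\in J_i\cap S_k: j'\le j\}|$ (the total completion time of scenario $k$ when each machine processes its jobs from $S_k$ in Shortest-Processing-Time order with processing times $p_j=w_j$, skipping jobs not in $S_k$). MinAvgSTC asks to minimize $\sum_{k=1}^K G(\varphi,k)$. *)

theory Defs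
  imports
    "HOL-Library.Discrete_Functions"
    "HOL-Library.FuncSet"
    "HOL-Computational_Algebra.Polynomial"
begin

text \<open>
  Polynomial time is understood with respect to a random access machine over the natural numbers
  with logarithmic cost. Programs are structured; the memory consists of registers and of arrays
  with indirect addressing. A program mentions only finitely many registers and arrays. Under the
  logarithmic cost measure this model, including multiplication and division, is polynomially
  equivalent to deterministic Turing machines.
\<close>

datatype expr =
    Const nat
  | Reg nat
  | Arr nat expr
  | Plus expr expr
  | Monus expr expr
  | Times expr expr
  | Div expr expr

datatype prog =
    Skip
  | Assign nat expr
  | Store nat expr expr
  | Seq prog prog
  | Cond expr prog prog
  | While expr prog

record state =
  reg :: "nat \<Rightarrow> nat"
  arr :: "nat \<Rightarrow> nat \<Rightarrow> nat"

fun val :: "expr \<Rightarrow> state \<Rightarrow> nat" where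
  "val (Const k) s = k"
| "val (Reg r) s = reg s r"
| "val (Arr a e) s = arr s a (val e s)"
| "val (Plus e f) s = val e s + val f s"
| "val (Monus e f) s = val e s - val f s"
| "val (Times e f) s = val e s * val f s"
| "val (Div e f) s = val e s div val f s"

text \<open>
  The logarithmic size: the number of binary digits of a number, where \<open>0\<close> has one digit.
\<close>

definition len :: "nat \<Rightarrow> nat" where
  "len k = Suc (floor_log k)"

text \<open>
  Evaluating an expression is charged with the sizes of the values of all its subexpressions; in
  particular operands, results and array indices are all accounted for.
\<close>

fun cost :: "expr \<Rightarrow> state \<Rightarrow> nat" where
  "cost (Const k) s = len k"
| "cost (Reg r) s = len (reg s r)"
| "cost (Arr a e) s = cost e s + len (val (Arr a e) s)"
| "cost (Plus e f) s = cost e s + cost f s + len (val (Plus e f) s)"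
| "cost (Monus e f) s = cost e s + cost f s + len (val (Monus e f) s)"
| "cost (Times e f) s = cost e s + cost f s + len (val (Times e f) s)"
| "cost (Div e f) s = cost e s + cost f s + len (val (Div e f) s)"

text \<open>
  \<open>exec c s t s'\<close>: started in \<open>s\<close>, program \<open>c\<close> terminates in \<open>s'\<close> with running time \<open>t\<close>.
  A test succeeds iff the value of its expression is nonzero.
\<close>

inductive exec :: "prog \<Rightarrow> state \<Rightarrow> nat \<Rightarrow> state \<Rightarrow> bool" where
  Skip: "exec Skip s 1 s"
| Assign: "exec (Assign r e) s (cost e s) (s\<lparr>reg := (reg s)(r := val e s)\<rparr>)"
| Store: "exec (Store a i e) s (cost i s + cost e s)
    (s\<lparr>arr := (arr s)(a := (arr s a)(val i s := val e s))\<rparr>)"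
| Seq: "exec c s t s' \<Longrightarrow> exec d s' u s'' \<Longrightarrow> exec (Seq c d) s (t + u) s''"
| CondTrue: "val e s \<noteq> 0 \<Longrightarrow> exec c s t s' \<Longrightarrow> exec (Cond e c d) s (cost e s + t) s'"
| CondFalse: "val e s = 0 \<Longrightarrow> exec d s t s' \<Longrightarrow> exec (Cond e c d) s (cost e s + t) s'"
| WhileFalse: "val e s = 0 \<Longrightarrow> exec (While e c) s (cost e s) s"
| WhileTrue: "val e s \<noteq> 0 \<Longrightarrow> exec c s t s' \<Longrightarrow> exec (While e c) s' u s'' \<Longrightarrow>
    exec (While e c) s (cost e s + t + u) s''"

lemma exec_deterministic:
  "exec c s t s' \<Longrightarrow> exec c s u s'' \<Longrightarrow> t = u \<and> s' = s''"
proof (induction arbitrary: u s'' rule: exec.induct)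
  case (Skip s)
  then show ?case by cases simp
next
  case (Assign r e s)
  then show ?case by cases simp
next
  case (Store a i e s)
  then show ?case by cases simp
next
  case (Seq c s t s' d u s'')
  from Seq.prems show ?case by cases (use Seq.IH in blast)
next
  case (CondTrue e s c t s' d)
  from CondTrue.prems show ?case by cases (use CondTrue.hyps CondTrue.IH in blast)+
next
  case (CondFalse e s d t s' c)
  from CondFalse.prems show ?case by cases (use CondFalse.hyps CondFalse.IH in blast)+
next
  case (WhileFalse e s c)
  from WhileFalse.prems show ?case by cases (use WhileFalse.hyps in blast)+
next
  case (WhileTrue e s c t s' u s'')
  from WhileTrue.prems show ?case by cases (use WhileTrue.hyps WhileTrue.IH in blast)+
qed

text \<open>
  The input is a list of numbers, stored in array \<open>0\<close> with its length in register \<open>0\<close>; all other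
  cells are initially \<open>0\<close>. The output is read off array \<open>1\<close>, its length off register \<open>1\<close>.
\<close>

definition initial :: "nat list \<Rightarrow> state" where
  "initial xs =
    \<lparr>reg = (\<lambda>_. 0)(0 := length xs),
     arr = (\<lambda>_ _. 0)(0 := (\<lambda>i. if i < length xs then xs ! i else 0))\<rparr>"

definition result :: "state \<Rightarrow> nat list" where
  "result s = map (arr s 1) [0..<reg s 1]"

definition input_size :: "nat list \<Rightarrow> nat" where
  "input_size xs = sum_list (map len xs)"

definition poly_time_solvable ::
    "'i set \<Rightarrow> ('i \<Rightarrow> nat list) \<Rightarrow> ('i \<Rightarrow> nat list \<Rightarrow> bool) \<Rightarrow> bool" where
  "poly_time_solvable instances enc is_solution \<longleftrightarrow>
    (\<exists>(c :: prog) (p :: nat poly). \<forall>x\<in>instances. \<exists>t s.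
      exec c (initial (enc x)) t s \<and>
      t \<le> poly p (input_size (enc x)) \<and>
      is_solution x (result s))"

text \<open>
  Weights are rational, so that instances have a finite binary encoding. Only the values
  of \<open>weight\<close> on the jobs \<open>{1..n}\<close> and of \<open>scenario\<close> on \<open>{1..K}\<close> are meaningful.
\<close>

record stc_instance =
  num_jobs :: nat
  num_machines :: nat
  num_scenarios :: nat
  weight :: "nat \<Rightarrow> rat"
  scenario :: "nat \<Rightarrow> nat set"

definition stc_valid :: "stc_instance \<Rightarrow> bool" where
  "stc_valid I \<longleftrightarrow>
    (\<forall>j\<in>{1..num_jobs I}. 0 \<le> weight I j) \<and>
    (\<forall>j\<in>{1..num_jobs I}. \<forall>j'\<in>{1..num_jobs I}. j \<le> j' \<longrightarrow> weight I j' \<le> weight I j) \<and>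
    (\<forall>k\<in>{1..num_scenarios I}. scenario I k \<subseteq> {1..num_jobs I})"

definition assignments :: "stc_instance \<Rightarrow> (nat \<Rightarrow> nat) set" where
  "assignments I = {1..num_jobs I} \<rightarrow> {1..num_machines I}"

definition jobs_on :: "stc_instance \<Rightarrow> (nat \<Rightarrow> nat) \<Rightarrow> nat \<Rightarrow> nat set" where
  "jobs_on I \<phi> i = {j \<in> {1..num_jobs I}. \<phi> j = i}"

definition scenario_cost :: "stc_instance \<Rightarrow> (nat \<Rightarrow> nat) \<Rightarrow> nat \<Rightarrow> rat" where
  "scenario_cost I \<phi> k =
    (\<Sum>i = 1..num_machines I. \<Sum>j \<in> jobs_on I \<phi> i \<inter> scenario I k.
      weight I j * of_nat (card {j' \<in> jobs_on I \<phi> i \<inter> scenario I k. j' \<le> j}))"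

definition total_cost :: "stc_instance \<Rightarrow> (nat \<Rightarrow> nat) \<Rightarrow> rat" where
  "total_cost I \<phi> = (\<Sum>k = 1..num_scenarios I. scenario_cost I \<phi> k)"

definition MinAvgSTC_optimal :: "stc_instance \<Rightarrow> (nat \<Rightarrow> nat) \<Rightarrow> bool" where
  "MinAvgSTC_optimal I \<phi> \<longleftrightarrow>
    \<phi> \<in> assignments I \<and> (\<forall>\<psi>\<in>assignments I. total_cost I \<phi> \<le> total_cost I \<psi>)"

definition MinAvgSTC_instances :: "nat \<Rightarrow> nat \<Rightarrow> stc_instance set" where
  "MinAvgSTC_instances m K = {I. stc_valid I \<and> num_machines I = m \<and> num_scenarios I = K}"

text \<open>
  The encoding lists \<open>n\<close>, \<open>m\<close>, \<open>K\<close>, then the weights as reduced fractions (numerator,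
  denominator), then the characteristic vectors of the scenarios. The conversion \<open>nat\<close> loses
  nothing, since numerators are non-negative on valid instances and denominators are positive.
\<close>

definition encode :: "stc_instance \<Rightarrow> nat list" where
  "encode I =
    [num_jobs I, num_machines I, num_scenarios I] @
    concat (map (\<lambda>j. [nat (fst (quotient_of (weight I j))), nat (snd (quotient_of (weight I j)))])
      [1..<Suc (num_jobs I)]) @
    concat (map (\<lambda>k. map (\<lambda>j. of_bool (j \<in> scenario I k)) [1..<Suc (num_jobs I)])
      [1..<Suc (num_scenarios I)])"

text \<open>
  An output list has the machine of job \<open>j\<close> at (zero-based) position \<open>j - 1\<close>.
\<close>

definition MinAvgSTC_solution :: "stc_instance \<Rightarrow> nat list \<Rightarrow> bool" where
  "MinAvgSTC_solution I ys \<longleftrightarrow>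
    length ys = num_jobs I \<and> MinAvgSTC_optimal I (\<lambda>j. ys ! (j - 1))"

end

theory Submission
  imports Defs
begin

text \<open>
  Assign the jobs in order of their index. The cost of putting the next job on machine \<open>i\<close>
  depends on the past only through the numbers of earlier jobs on each machine in each scenario.
  These \<open>mK\<close> counters are digits in base \<open>n + 2\<close> of a single number, whose leading part is
  the number of remaining jobs; so a table with \<open>n (n + 2)\<^sup>m\<^sup>K\<close> relevant entries holds the optimal
  cost-to-go of every situation, and an optimal assignment is read off by following minimisers.
  Weights are made integral by multiplying them with the product of all denominators.

  With \<open>m\<close> and \<open>K\<close> constant, everything done for one table entry is a single expression. The
  running time is polynomial because all memory cells stay below \<open>2\<^sup>L\<close> with \<open>L\<close> polynomial in the
  input size, which bounds the cost of each expression by a constant times \<open>L\<close>.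
\<close>

section \<open>Running times of programs over bounded memory\<close>

definition bounded :: "nat \<Rightarrow> state \<Rightarrow> bool" where
  "bounded L s \<longleftrightarrow> 0 < L \<and> (\<forall>r. reg s r \<le> 2 ^ L) \<and> (\<forall>a i. arr s a i \<le> 2 ^ L)"

text \<open>Exponent factor: over memory bounded by \<open>2 ^ L\<close>, values are at most
  \<open>2 ^ (L * growth e)\<close>. An array access resets it to 1, since every cell obeys the
  bound whatever its index.\<close>

fun growth :: "expr \<Rightarrow> nat" where
  "growth (Const k) = Suc k"
| "growth (Reg r) = 1"
| "growth (Arr a e) = 1"
| "growth (Plus e f) = growth e + growth f"
| "growth (Monus e f) = growth e + growth f"
| "growth (Times e f) = growth e + growth f"
| "growth (Div e f) = growth e + growth f"

text \<open>Each node is charged twice its \<open>growth\<close>: a number up to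
  \<open>2 ^ a\<close> has at most \<open>a + 1 \<le> 2 * a\<close> digits when \<open>a\<close> is
  positive.\<close>

fun cost_factor :: "expr \<Rightarrow> nat" where
  "cost_factor (Const k) = 2 * Suc k"
| "cost_factor (Reg r) = 2"
| "cost_factor (Arr a e) = cost_factor e + 2"
| "cost_factor (Plus e f) = cost_factor e + cost_factor f + 2 * (growth e + growth f)"
| "cost_factor (Monus e f) = cost_factor e + cost_factor f + 2 * (growth e + growth f)"
| "cost_factor (Times e f) = cost_factor e + cost_factor f + 2 * (growth e + growth f)"
| "cost_factor (Div e f) = cost_factor e + cost_factor f + 2 * (growth e + growth f)"

lemma len_le:
  assumes "k \<le> 2 ^ a"
  shows "len k \<le> Suc a"
proof -
  have "floor_log k \<le> floor_log (2 ^ a)"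
    by (rule monoD[OF floor_log_mono assms])
  then show ?thesis by (simp add: len_def)
qed

lemma le_power_len: "k \<le> 2 ^ len k"
proof (cases "k = 0")
  case False
  then show ?thesis
    using floor_log_exp2_gt[of k] by (simp add: len_def)
qed simp

lemma growth_pos: "0 < growth e"
  by (induction e) auto

text \<open>For numbers that are at least 2 the sum is at most the product; the conjunct
  \<open>0 < L\<close> of \<open>bounded\<close> secures the positive exponents.\<close>

lemma add_le_two_power:
  assumes "x \<le> 2 ^ a" "y \<le> 2 ^ b" "0 < a" "0 < b"
  shows "x + y \<le> (2::nat) ^ (a + b)"
proof -
  have "2 \<le> (2::nat) ^ a" "2 \<le> (2::nat) ^ b"
    using assms(3,4) self_le_power[of "2::nat"] by auto
  then obtain u v where "(2::nat) ^ a = 2 + u" "(2::nat) ^ b = 2 + v"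
    by (meson le_Suc_ex)
  then have "(2::nat) ^ a + 2 ^ b \<le> 2 ^ a * 2 ^ b" by (simp add: algebra_simps)
  then show ?thesis using assms(1,2) by (simp add: power_add)
qed

lemma val_le:
  assumes "bounded L s"
  shows "val e s \<le> 2 ^ (L * growth e)"
proof (induction e)
  case (Const k)
  have "k \<le> 2 ^ k" by (simp add: less_imp_le)
  also have "\<dots> \<le> 2 ^ (L * Suc k)"
    using assms by (intro power_increasing) (cases L, auto simp: bounded_def)
  finally show ?case by simp
next
  case (Plus e f)
  then show ?case
    using add_le_two_power[OF Plus] assms growth_pos
    by (simp add: bounded_def distrib_left)
next
  case (Monus e f)
  have "val e s - val f s \<le> 2 ^ (L * growth e)" using Monus(1) by linarith
  also have "\<dots> \<le> 2 ^ (L * growth (Monus e f))" by (intro power_increasing) auto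
  finally show ?case by simp
next
  case (Times e f)
  then show ?case by (simp add: distrib_left power_add mult_mono)
next
  case (Div e f)
  have "val e s div val f s \<le> 2 ^ (L * growth e)"
    using Div(1) div_le_dividend le_trans by blast
  also have "\<dots> \<le> 2 ^ (L * growth (Div e f))" by (intro power_increasing) auto
  finally show ?case by simp
qed (use assms in \<open>auto simp: bounded_def\<close>)

lemma len_val_le:
  assumes "bounded L s"
  shows "len (val e s) \<le> 2 * growth e * L"
proof -
  have "len (val e s) \<le> Suc (L * growth e)" using len_le val_le[OF assms] by blast
  moreover have "0 < L * growth e" using assms growth_pos by (simp add: bounded_def)
  ultimately have "len (val e s) \<le> 2 * (L * growth e)" by linarith
  then show ?thesis by (simp add: mult_ac)
qed

lemma cost_le:
  assumes "bounded L s"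
  shows "cost e s \<le> cost_factor e * L"
proof (induction e)
  case (Const k)
  then show ?case using len_val_le[OF assms, of "Const k"] by simp
next
  case (Reg r)
  then show ?case using len_val_le[OF assms, of "Reg r"] by simp
next
  case (Arr a e)
  then show ?case using len_val_le[OF assms, of "Arr a e"] by (simp add: algebra_simps)
next
  case (Plus e f)
  then show ?case using len_val_le[OF assms, of "Plus e f"] by (simp add: algebra_simps)
next
  case (Monus e f)
  then show ?case using len_val_le[OF assms, of "Monus e f"] by (simp add: algebra_simps)
next
  case (Times e f)
  then show ?case using len_val_le[OF assms, of "Times e f"] by (simp add: algebra_simps)
next
  case (Div e f)
  then show ?case using len_val_le[OF assms, of "Div e f"] by (simp add: algebra_simps)
qed

fun prog_factor :: "prog \<Rightarrow> nat" where
  "prog_factor Skip = 1"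
| "prog_factor (Assign r e) = cost_factor e"
| "prog_factor (Store a i e) = cost_factor i + cost_factor e"
| "prog_factor (Seq c d) = prog_factor c + prog_factor d"
| "prog_factor (Cond e c d) = cost_factor e + prog_factor c + prog_factor d"
| "prog_factor (While e c) = cost_factor e + prog_factor c"

text \<open>
  Here \<open>k\<close> counts elementary steps; \<open>prog_factor c\<close> depends on the program only, so it is
  a constant when \<open>m\<close> and \<open>K\<close> are.
\<close>

definition runs :: "nat \<Rightarrow> prog \<Rightarrow> state \<Rightarrow> nat \<Rightarrow> state \<Rightarrow> bool" where
  "runs L c s k s' \<longleftrightarrow> (\<exists>t. exec c s t s' \<and> t \<le> k * prog_factor c * L)"

lemma runs_Assign:
  assumes "bounded L s" "s\<lparr>reg := (reg s)(r := val e s)\<rparr> = s'"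
  shows "runs L (Assign r e) s 1 s'"
  unfolding runs_def assms(2)[symmetric] using cost_le[OF assms(1)] exec.Assign by fastforce

lemma runs_Store:
  assumes "bounded L s" "s\<lparr>arr := (arr s)(a := (arr s a)(val i s := val e s))\<rparr> = s'"
  shows "runs L (Store a i e) s 1 s'"
proof -
  have "cost i s + cost e s \<le> 1 * prog_factor (Store a i e) * L"
    using cost_le[OF assms(1), of i] cost_le[OF assms(1), of e] by (simp add: distrib_right)
  then show ?thesis
    unfolding runs_def assms(2)[symmetric] using exec.Store by blast
qed

lemma runs_Seq:
  assumes "runs L c s k s'" "runs L d s' l s''"
  shows "runs L (Seq c d) s (k + l) s''"
proof -
  obtain t u where t: "exec c s t s'" "t \<le> k * prog_factor c * L"
    and u: "exec d s' u s''" "u \<le> l * prog_factor d * L"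
    using assms unfolding runs_def by blast
  have "t + u \<le> (k + l) * prog_factor (Seq c d) * L"
    using t(2) u(2) by (simp add: algebra_simps)
  then show ?thesis unfolding runs_def using exec.Seq[OF t(1) u(1)] by blast
qed

text \<open>\<open>\<sigma> i\<close> is the state after \<open>i\<close> rounds. A round pays one
  step for its test and \<open>b\<close> for its body, and the final \<open>+ 1\<close> pays for the
  failing test; the exact number \<open>k\<close> of rounds enters only through its bound
  \<open>N\<close>.\<close>

lemma runs_While:
  assumes "\<And>i. i < k \<Longrightarrow> val e (\<sigma> i) \<noteq> 0" "val e (\<sigma> k) = 0"
    and "\<And>i. i < k \<Longrightarrow> runs L c (\<sigma> i) b (\<sigma> (Suc i))"
    and "\<And>i. i \<le> k \<Longrightarrow> bounded L (\<sigma> i)"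
    and "k \<le> N" "\<sigma> 0 = s" "\<sigma> k = s'"
  shows "runs L (While e c) s (N * (1 + b) + 1) s'"
  using assms
proof (induction k arbitrary: \<sigma> s N)
  case 0
  have "cost e (\<sigma> 0) \<le> cost_factor e * L" using cost_le 0 by blast
  also have "\<dots> \<le> (N * (1 + b) + 1) * prog_factor (While e c) * L"
    by (simp add: algebra_simps)
  finally show ?case unfolding runs_def using exec.WhileFalse 0 by metis
next
  case (Suc k)
  obtain N' where N: "N = Suc N'" using Suc.prems(5) by (cases N) auto
  have "runs L (While e c) (\<sigma> (Suc 0)) (N' * (1 + b) + 1) s'"
    by (rule Suc.IH[of "\<lambda>i. \<sigma> (Suc i)"]) (use Suc.prems N in auto)
  then obtain u where u: "exec (While e c) (\<sigma> (Suc 0)) u s'"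
    "u \<le> (N' * (1 + b) + 1) * prog_factor (While e c) * L"
    unfolding runs_def by blast
  obtain t where t: "exec c (\<sigma> 0) t (\<sigma> (Suc 0))" "t \<le> b * prog_factor c * L"
    using Suc.prems(3)[of 0] unfolding runs_def by blast
  have "exec (While e c) s (cost e s + t + u) s'"
    using exec.WhileTrue[OF _ t(1) u(1)] Suc.prems(1)[of 0] Suc.prems(6) by simp
  moreover have "cost e s + t + u \<le> (N * (1 + b) + 1) * prog_factor (While e c) * L"
    using cost_le[of L s e] Suc.prems(4)[of 0] Suc.prems(6) t(2) u(2) N
    by (simp add: algebra_simps)
  ultimately show ?case unfolding runs_def by blast
qed

section \<open>Derived expressions\<close>

text \<open>Argmin over the indices up to \<open>i\<close>, ties going to the smallest
  index.\<close>

primrec amin :: "(nat \<Rightarrow> nat) \<Rightarrow> nat \<Rightarrow> nat" where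
  "amin f 0 = 0"
| "amin f (Suc i) = (if f (amin f i) \<le> f (Suc i) then amin f i else Suc i)"

lemma amin_le: "amin f i \<le> i"
  by (induction i) auto

lemma amin_minimal: "k \<le> i \<Longrightarrow> f (amin f i) \<le> f k"
  by (induction i) (auto simp: le_Suc_eq)

primrec sumE :: "(nat \<Rightarrow> expr) \<Rightarrow> nat \<Rightarrow> expr" where
  "sumE f 0 = Const 0"
| "sumE f (Suc d) = Plus (sumE f d) (f d)"

primrec powE :: "expr \<Rightarrow> nat \<Rightarrow> expr" where
  "powE e 0 = Const 1"
| "powE e (Suc d) = Times e (powE e d)"

text \<open>With truncated subtraction, \<open>x - (x - y)\<close> is the minimum. The doubling of
  \<open>minE f i\<close> makes the expression exponential in \<open>i\<close>, which is harmless
  since \<open>i < m\<close> with \<open>m\<close> constant.\<close>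

primrec minE :: "(nat \<Rightarrow> expr) \<Rightarrow> nat \<Rightarrow> expr" where
  "minE f 0 = f 0"
| "minE f (Suc i) = Monus (minE f i) (Monus (minE f i) (f (Suc i)))"

definition leE :: "expr \<Rightarrow> expr \<Rightarrow> expr" where
  "leE e f = Monus (Const 1) (Monus e f)"

text \<open>Expressions have no case distinction, so a comparison bit and its complement select
  between two candidates by multiplication. Keeping the returned \<open>g\<close> apart from the key
  \<open>f\<close> lets one argmin yield either a machine number or a successor index.\<close>

primrec aminE :: "(nat \<Rightarrow> expr) \<Rightarrow> (nat \<Rightarrow> expr) \<Rightarrow> nat \<Rightarrow> expr" where
  "aminE f g 0 = g 0"
| "aminE f g (Suc i) = Plus (Times (leE (minE f i) (f (Suc i))) (aminE f g i))
     (Times (Monus (Const 1) (leE (minE f i) (f (Suc i)))) (g (Suc i)))"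

lemma val_sumE [simp]: "val (sumE f d) s = (\<Sum>i<d. val (f i) s)"
  by (induction d) auto

lemma val_powE [simp]: "val (powE e d) s = val e s ^ d"
  by (induction d) auto

lemma val_minE [simp]: "val (minE f i) s = val (f (amin (\<lambda>k. val (f k) s) i)) s"
  by (induction i) auto

lemma val_aminE [simp]: "val (aminE f g i) s = val (g (amin (\<lambda>k. val (f k) s) i)) s"
  by (induction i) (auto simp: leE_def)

section \<open>The program\<close>

text \<open>
  Registers: 0 holds \<open>n\<close>, 1 the output counter, 2 the product of the denominators, 3 the counter of
  the first loop, 4 the base \<open>n + 2\<close>, 5 its power \<open>(n + 2)\<^sup>m\<^sup>K\<close>, and 6 the current table index.
  The table is array 2. Its entries below the index in register 5 (no jobs remaining) keep their
  initial value 0.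
\<close>

definition jobE :: expr where
  "jobE = Monus (Reg 0) (Div (Reg 6) (Reg 5))"

text \<open>The fractions are stored in pairs from cell 3 on. The job's own denominator divides the
  product in register 2, so the division is exact.\<close>

definition weightE :: expr where
  "weightE = Times (Arr 0 (Plus (Const 3) (Times (Const 2) jobE)))
     (Div (Reg 2) (Arr 0 (Plus (Const 4) (Times (Const 2) jobE))))"

text \<open>The characteristic vectors follow the \<open>3 + 2 * n\<close> cells of header and
  weights, with \<open>n\<close> cells per scenario.\<close>

definition memberE :: "nat \<Rightarrow> expr" where
  "memberE k = Arr 0 (Plus (Plus (Const 3) (Times (Const (k + 2)) (Reg 0))) jobE)"

text \<open>Remainder modulo the base, as \<open>x - B * (x div B)\<close>. Digit \<open>d\<close>
  counts the jobs of scenario \<open>d mod K\<close> on machine \<open>d div K\<close>.\<close>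

definition digitE :: "nat \<Rightarrow> expr" where
  "digitE d = Monus (Div (Reg 6) (powE (Reg 4) d))
     (Times (Reg 4) (Div (Div (Reg 6) (powE (Reg 4) d)) (Reg 4)))"

text \<open>Positions of the job on machine \<open>i\<close>, summed over the scenarios containing
  it. Times the weight, this is the whole cost caused by the job, since later jobs never precede
  it.\<close>

definition posE :: "nat \<Rightarrow> nat \<Rightarrow> nat \<Rightarrow> expr" where
  "posE m K i = sumE (\<lambda>d. if d div K = i
     then Times (memberE (d mod K)) (Plus (digitE d) (Const 1)) else Const 0) (m * K)"

text \<open>The subtraction takes one job off the remaining ones; each added power raises the
  counter of one scenario on machine \<open>i\<close>.\<close>

definition nextE :: "nat \<Rightarrow> nat \<Rightarrow> nat \<Rightarrow> expr" where
  "nextE m K i = Plus (Monus (Reg 6) (Reg 5)) (sumE (\<lambda>d. if d div K = i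
     then Times (memberE (d mod K)) (powE (Reg 4) d) else Const 0) (m * K))"

definition keyE :: "nat \<Rightarrow> nat \<Rightarrow> nat \<Rightarrow> expr" where
  "keyE m K i = Plus (Times weightE (posE m K i)) (Arr 2 (nextE m K i))"

definition denom_loop :: prog where
  "denom_loop = While (Monus (Reg 0) (Reg 3))
     (Seq (Assign 2 (Times (Reg 2) (Arr 0 (Plus (Const 4) (Times (Const 2) (Reg 3))))))
       (Assign 3 (Plus (Reg 3) (Const 1))))"

definition table_loop :: "nat \<Rightarrow> nat \<Rightarrow> prog" where
  "table_loop m K = While (Monus (Times (Plus (Reg 0) (Const 1)) (Reg 5)) (Reg 6))
     (Seq (Store 2 (Reg 6) (minE (keyE m K) (m - 1))) (Assign 6 (Plus (Reg 6) (Const 1))))"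

text \<open>The machine number, shifted to start from 1, is written before register 6 moves on,
  since both are computed from the current index.\<close>

definition output_loop :: "nat \<Rightarrow> nat \<Rightarrow> prog" where
  "output_loop m K = While (Monus (Reg 0) (Reg 1))
     (Seq (Store 1 (Reg 1) (aminE (keyE m K) (\<lambda>i. Const (Suc i)) (m - 1)))
       (Seq (Assign 6 (aminE (keyE m K) (nextE m K) (m - 1)))
         (Assign 1 (Plus (Reg 1) (Const 1)))))"

text \<open>Register 0 starts with the length of the input and is overwritten by \<open>n\<close>,
  the first input entry. The output walk starts where all jobs remain and all counters are
  0.\<close>

definition stc_prog :: "nat \<Rightarrow> nat \<Rightarrow> prog" where
  "stc_prog m K =
     Seq (Assign 0 (Arr 0 (Const 0)))
    (Seq (Assign 2 (Const 1))
    (Seq denom_loop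
    (Seq (Assign 4 (Plus (Reg 0) (Const 2)))
    (Seq (Assign 5 (powE (Reg 4) (m * K)))
    (Seq (Assign 6 (Reg 5))
    (Seq (table_loop m K)
    (Seq (Assign 6 (Times (Reg 0) (Reg 5)))
      (output_loop m K))))))))"

section \<open>The recursion behind the table\<close>

lemma sum_digits_less:
  assumes "\<And>d. d < l \<Longrightarrow> y d < B"
  shows "(\<Sum>d<l. y d * B ^ d) < (B::nat) ^ l"
  using assms
proof (induction l)
  case (Suc l)
  have "(\<Sum>d<l. y d * B ^ d) < B ^ l" using Suc by simp
  then have "(\<Sum>d<Suc l. y d * B ^ d) < Suc (y l) * B ^ l" by simp
  also have "\<dots> \<le> B * B ^ l" using Suc.prems[of l] by (intro mult_right_mono) auto
  finally show ?case by simp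
qed simp

text \<open>The leading part \<open>a\<close> is arbitrary, so that the induction can absorb the top
  digit into it.\<close>

lemma digit_of_sum:
  assumes "\<And>d. d < l \<Longrightarrow> y d < B" and "d < l"
  shows "((a * B ^ l + (\<Sum>d<l. y d * B ^ d)) div B ^ d) mod B = (y d :: nat)"
  using assms
proof (induction l arbitrary: a)
  case (Suc l)
  have B: "0 < B" using Suc.prems by fastforce
  have split: "a * B ^ Suc l + (\<Sum>d<Suc l. y d * B ^ d)
      = (a * B + y l) * B ^ l + (\<Sum>d<l. y d * B ^ d)"
    by (simp add: algebra_simps)
  show ?case
  proof (cases "d = l")
    case True
    have "(\<Sum>d<l. y d * B ^ d) < B ^ l" by (rule sum_digits_less) (use Suc in auto)
    then show ?thesis
      unfolding split True using Suc.prems(1)[of l] B by simp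
  next
    case False
    then show ?thesis unfolding split using Suc by simp
  qed
qed simp

section \<open>The dynamic program in mathematical form\<close>

locale stc_dp =
  fixes inp :: "nat \<Rightarrow> nat" and n m K D :: nat
  assumes m_pos: "1 \<le> m"
    and bits: "\<And>k j. k < K \<Longrightarrow> j < n \<Longrightarrow> inp (3 + (k + 2) * n + j) \<le> 1"
begin

text \<open>Counters reach at most \<open>n\<close>; \<open>n + 2\<close> exceeds them and stays
  above 1 even when \<open>n = 0\<close>.\<close>

definition base :: nat where "base = n + 2"

definition tsize :: nat where "tsize = base ^ (m * K)"

definition job :: "nat \<Rightarrow> nat" where "job q = n - q div tsize"

definition wt :: "nat \<Rightarrow> nat" where
  "wt j = inp (3 + 2 * j) * (D div inp (4 + 2 * j))"

definition mem :: "nat \<Rightarrow> nat \<Rightarrow> nat" where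
  "mem k j = inp (3 + (k + 2) * n + j)"

definition pos :: "nat \<Rightarrow> nat \<Rightarrow> nat" where
  "pos q i = (\<Sum>d<m * K. if d div K = i
     then mem (d mod K) (job q) * (q div base ^ d mod base + 1) else 0)"

definition nxt :: "nat \<Rightarrow> nat \<Rightarrow> nat" where
  "nxt q i = q - tsize + (\<Sum>d<m * K. if d div K = i
     then mem (d mod K) (job q) * base ^ d else 0)"

definition key :: "(nat \<Rightarrow> nat) \<Rightarrow> nat \<Rightarrow> nat \<Rightarrow> nat" where
  "key A q i = wt (job q) * pos q i + A (nxt q i)"

definition best :: "(nat \<Rightarrow> nat) \<Rightarrow> nat \<Rightarrow> nat" where
  "best A q = amin (key A q) (m - 1)"

text \<open>
  Table indices that encode no reachable counter values yield junk entries; these only need to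
  stay small.
\<close>

primrec table :: "nat \<Rightarrow> nat \<Rightarrow> nat" where
  "table 0 = (\<lambda>_. 0)"
| "table (Suc t) = (table t)(tsize + t := key (table t) (tsize + t) (best (table t) (tsize + t)))"

abbreviation opt :: "nat \<Rightarrow> nat" where "opt \<equiv> table (n * tsize)"

text \<open>Table indices visited when the jobs are assigned by \<open>\<phi>\<close>, from the
  index with all \<open>n\<close> jobs remaining and zero counters.\<close>

primrec path :: "(nat \<Rightarrow> nat) \<Rightarrow> nat \<Rightarrow> nat" where
  "path \<phi> 0 = n * tsize"
| "path \<phi> (Suc j) = nxt (path \<phi> j) (\<phi> j)"

definition occ :: "(nat \<Rightarrow> nat) \<Rightarrow> nat \<Rightarrow> nat \<Rightarrow> nat \<Rightarrow> nat" where
  "occ \<phi> j i k = (\<Sum>l<j. if \<phi> l = i then mem k l else 0)"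

text \<open>Total cost scaled by \<open>D\<close>, regrouped by job.\<close>

definition obj :: "(nat \<Rightarrow> nat) \<Rightarrow> nat" where
  "obj \<phi> = (\<Sum>j<n. wt j * (\<Sum>k<K. mem k j * (occ \<phi> j (\<phi> j) k + 1)))"

section \<open>The Bellman equation of the table\<close>

lemma base_gt_1: "1 < base" by (simp add: base_def)

lemma tsize_pos: "0 < tsize" by (simp add: tsize_def base_def)

lemma mem_le: "k < K \<Longrightarrow> j < n \<Longrightarrow> mem k j \<le> 1"
  using bits by (simp add: mem_def)

lemma best_less: "best A q < m"
  using amin_le[of "key A q" "m - 1"] m_pos by (simp add: best_def)

lemma key_best_le: "i < m \<Longrightarrow> key A q (best A q) \<le> key A q i"
  unfolding best_def by (rule amin_minimal) auto

lemma table_0: "p < tsize \<Longrightarrow> table t p = 0"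
  by (induction t) auto

text \<open>Each round writes a single index, and these indices increase, so everything below the
  current one is final.\<close>

lemma table_stable: "p < tsize + t \<Longrightarrow> t \<le> u \<Longrightarrow> table u p = table t p"
proof (induction u)
  case (Suc u)
  then show ?case by (cases "t = Suc u") auto
qed simp

lemma job_less: "tsize \<le> q \<Longrightarrow> q < (n + 1) * tsize \<Longrightarrow> job q < n"
  unfolding job_def using tsize_pos
  by (metis (no_types, lifting) One_nat_def Suc_eq_plus1 diff_less div_greater_zero_iff
      less_mult_imp_div_less less_Suc_eq_le order_less_le_trans)

text \<open>The increments are digits 0 or 1 in base \<open>base\<close>, so together they stay
  below one leading unit.\<close>

lemma increment_less:
  assumes "j < n"
  shows "(\<Sum>d<m * K. if d div K = i then mem (d mod K) j * base ^ d else 0) < tsize"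
proof -
  have "mem (d mod K) j < base" if "d < m * K" for d
  proof -
    have "d mod K < K" using that by (cases "K = 0") auto
    then show ?thesis using mem_le[OF _ assms] base_gt_1 by (meson order_le_less_trans)
  qed
  then have "(\<Sum>d<m * K. (if d div K = i then mem (d mod K) j else 0) * base ^ d) < tsize"
    unfolding tsize_def using base_gt_1 by (intro sum_digits_less) auto
  then show ?thesis by (simp add: if_distrib[of "\<lambda>x. x * _"] cong: if_cong)
qed

text \<open>One leading unit is removed and less than one is added back. Hence filling the table in
  increasing order consults only finished entries.\<close>

lemma nxt_less:
  assumes "tsize \<le> q" "q < (n + 1) * tsize"
  shows "nxt q i < q"
  using increment_less[OF job_less[OF assms], of i] assms(1) by (simp add: nxt_def)

text \<open>The entry was computed from an intermediate table, but from smaller indices only, and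
  these were final already.\<close>

lemma opt_eq:
  assumes "tsize \<le> q" "q < (n + 1) * tsize"
  shows "opt q = key opt q (best opt q)"
proof -
  obtain t where t: "q = tsize + t" using assms(1) le_Suc_ex by blast
  have tn: "Suc t \<le> n * tsize" using assms(2) t by simp
  have same: "key (table t) q i = key opt q i" for i
    unfolding key_def
    using table_stable[of "nxt q i" t "n * tsize"] nxt_less[OF assms, of i] t tn by simp
  then have same': "key (table t) q = key opt q" by blast
  have "opt q = table (Suc t) q" using table_stable[of q "Suc t"] t tn by simp
  also have "\<dots> = key (table t) q (best (table t) q)" by (simp add: t)
  finally show ?thesis by (simp add: same' best_def)
qed

section \<open>Walks through the table along an assignment\<close>

context
  fixes \<phi> :: "nat \<Rightarrow> nat"
begin

lemma occ_le: "k < K \<Longrightarrow> j \<le> n \<Longrightarrow> occ \<phi> j i k \<le> j"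
proof -
  assume "k < K" "j \<le> n"
  then have "occ \<phi> j i k \<le> (\<Sum>l<j. 1)"
    unfolding occ_def by (intro sum_mono) (use mem_le in auto)
  then show ?thesis by simp
qed

lemma digit_bound:
  assumes "d < m * K" "j \<le> n"
  shows "occ \<phi> j (d div K) (d mod K) < base"
proof -
  have "d mod K < K" using assms(1) by (cases "K = 0") auto
  then show ?thesis using occ_le[of "d mod K" j] assms(2)
    unfolding base_def by (meson le_trans less_add_same_cancel1 le_less_trans zero_less_numeral)
qed

text \<open>All counters are below \<open>base\<close>, so no carry occurs, and quotient and digits
  can be read off.\<close>

lemma path_aux:
  assumes "q = a * tsize + (\<Sum>d<m * K. occ \<phi> j (d div K) (d mod K) * base ^ d)"
    and "j \<le> n"
  shows "q div tsize = a"
    and "d < m * K \<Longrightarrow> q div base ^ d mod base = occ \<phi> j (d div K) (d mod K)"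
proof -
  have "(\<Sum>d<m * K. occ \<phi> j (d div K) (d mod K) * base ^ d) < tsize"
    unfolding tsize_def by (rule sum_digits_less) (use digit_bound assms(2) in auto)
  then show "q div tsize = a" unfolding assms(1) by simp
  show "q div base ^ d mod base = occ \<phi> j (d div K) (d mod K)" if "d < m * K"
    unfolding assms(1) tsize_def
    using digit_of_sum[of "m * K" "\<lambda>d. occ \<phi> j (d div K) (d mod K)" base] digit_bound assms(2) that
    by blast
qed

text \<open>Invariant of the walk: a step recovers the job from the leading part, and what it adds
  to the digits is exactly the growth of \<open>occ\<close> from \<open>j\<close> to
  \<open>Suc j\<close>.\<close>

lemma path_eq:
  "j \<le> n \<Longrightarrow> path \<phi> j
     = (n - j) * tsize + (\<Sum>d<m * K. occ \<phi> j (d div K) (d mod K) * base ^ d)"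
proof (induction j)
  case 0
  then show ?case by (simp add: occ_def)
next
  case (Suc j)
  let ?q = "path \<phi> j"
  have q: "?q = (n - j) * tsize + (\<Sum>d<m * K. occ \<phi> j (d div K) (d mod K) * base ^ d)"
    using Suc by simp
  have job: "job ?q = j" using path_aux(1)[OF q] Suc.prems by (simp add: job_def)
  \<comment> \<open>At least one job remains, so taking off one \<open>tsize\<close> is not
    truncated.\<close>
  have "n - j = Suc (n - Suc j)" using Suc.prems by simp
  then have "path \<phi> (Suc j)
      = (n - Suc j) * tsize + ((\<Sum>d<m * K. occ \<phi> j (d div K) (d mod K) * base ^ d)
        + (\<Sum>d<m * K. if d div K = \<phi> j then mem (d mod K) j * base ^ d else 0))"
    unfolding path.simps nxt_def job by (simp add: q)
  also have "\<dots> = (n - Suc j) * tsize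
      + (\<Sum>d<m * K. occ \<phi> (Suc j) (d div K) (d mod K) * base ^ d)"
    unfolding sum.distrib[symmetric]
    by (intro arg_cong2[where f = "(+)"] sum.cong) (auto simp: occ_def distrib_right)
  finally show ?case .
qed

lemma job_path: "j \<le> n \<Longrightarrow> job (path \<phi> j) = j"
  using path_aux(1)[OF path_eq] by (simp add: job_def)

lemma path_range:
  assumes "j < n"
  shows "tsize \<le> path \<phi> j" "path \<phi> j < (n + 1) * tsize"
proof -
  have d: "path \<phi> j div tsize = n - j"
    using path_aux(1)[OF path_eq] assms by simp
  then show "tsize \<le> path \<phi> j" using assms tsize_pos
    by (metis div_less not_less zero_less_diff less_numeral_extra(3))
  show "path \<phi> j < (n + 1) * tsize"
    using d tsize_pos by (metis div_less_iff_less_mult diff_le_self le_imp_less_Suc Suc_eq_plus1)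
qed

lemma path_final: "opt (path \<phi> n) = 0"
proof -
  have "path \<phi> n div tsize = 0" using path_aux(1)[OF path_eq, of n] by simp
  then show ?thesis using tsize_pos by (simp add: table_0 div_eq_0_iff)
qed

text \<open>Writing \<open>d = i * K + k\<close> splits the digits into one block of length
  \<open>K\<close> per machine; only the block of machine \<open>\<phi> j\<close>
  contributes.\<close>

lemma pos_path:
  assumes "j < n" "\<phi> j < m"
  shows "pos (path \<phi> j) (\<phi> j) = (\<Sum>k<K. mem k j * (occ \<phi> j (\<phi> j) k + 1))"
proof -
  let ?h = "\<lambda>d. if d div K = \<phi> j then mem (d mod K) j * (occ \<phi> j (\<phi> j) (d mod K) + 1) else 0"
  have "pos (path \<phi> j) (\<phi> j) = sum ?h {..<m * K}"
    unfolding pos_def using path_aux(2)[OF path_eq] job_path assms(1)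
    by (intro sum.cong) auto
  also have "\<dots> = (\<Sum>i<m. sum ?h {i * K..<i * K + K})"
    by (simp only: sum.nat_group)
  also have "\<dots> = (\<Sum>i<m. \<Sum>k<K. ?h (i * K + k))"
  proof (rule sum.cong[OF refl])
    fix i
    show "sum ?h {i * K..<i * K + K} = (\<Sum>k<K. ?h (i * K + k))"
      using sum.shift_bounds_nat_ivl[of ?h 0 "i * K" K]
      by (simp only: lessThan_atLeast0 add.commute add_0_right add_0_left)
  qed
  also have "\<dots> = (\<Sum>i<m. if i = \<phi> j then \<Sum>k<K. mem k j * (occ \<phi> j (\<phi> j) k + 1) else 0)"
    by (intro sum.cong refl) (auto intro!: sum.cong)
  finally show ?thesis using assms(2) by simp
qed

lemma obj_eq:
  assumes "\<And>j. j < n \<Longrightarrow> \<phi> j < m"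
  shows "obj \<phi> = (\<Sum>j<n. wt (job (path \<phi> j)) * pos (path \<phi> j) (\<phi> j))"
  unfolding obj_def using assms by (intro sum.cong) (auto simp: pos_path job_path)

text \<open>By the Bellman equation, \<open>opt\<close> drops in each step by at most the cost of
  that step; the drops telescope, and the walk ends at value 0.\<close>

lemma opt_le_obj:
  assumes "\<And>j. j < n \<Longrightarrow> \<phi> j < m"
  shows "opt (n * tsize) \<le> obj \<phi>"
proof -
  have "opt (n * tsize)
      \<le> (\<Sum>l<j. wt (job (path \<phi> l)) * pos (path \<phi> l) (\<phi> l)) + opt (path \<phi> j)"
    if "j \<le> n" for j
    using that
  proof (induction j)
    case (Suc j)
    have "opt (path \<phi> j) \<le> key opt (path \<phi> j) (\<phi> j)"
      using opt_eq[OF path_range] key_best_le assms Suc.prems by simp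
    then show ?case using Suc by (simp add: key_def)
  qed simp
  from this[of n] show ?thesis by (simp add: obj_eq assms path_final)
qed

text \<open>When every step follows a minimiser, the same telescoping is exact.\<close>

lemma opt_eq_obj:
  assumes "\<And>j. j < n \<Longrightarrow> \<phi> j = best opt (path \<phi> j)"
  shows "opt (n * tsize) = obj \<phi>"
proof -
  have "opt (n * tsize)
      = (\<Sum>l<j. wt (job (path \<phi> l)) * pos (path \<phi> l) (\<phi> l)) + opt (path \<phi> j)"
    if "j \<le> n" for j
    using that
  proof (induction j)
    case (Suc j)
    have "opt (path \<phi> j) = key opt (path \<phi> j) (\<phi> j)"
      using opt_eq[OF path_range] assms Suc.prems by simp
    then show ?case using Suc by (simp add: key_def)
  qed simp
  from this[of n] show ?thesis using assms best_less by (simp add: obj_eq path_final)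
qed

end

text \<open>The minimising walk, defined without \<open>path\<close> because the assignment to be
  followed is itself read off the walk.\<close>

primrec trace :: "nat \<Rightarrow> nat" where
  "trace 0 = n * tsize"
| "trace (Suc j) = nxt (trace j) (best opt (trace j))"

definition choice :: "nat \<Rightarrow> nat" where
  "choice j = best opt (trace j)"

lemma path_choice: "path choice j = trace j"
  by (induction j) (auto simp: choice_def)

lemma choice_less: "choice j < m"
  by (simp add: choice_def best_less)

text \<open>Both sides are compared with the initial entry \<open>opt (n * tsize)\<close>.\<close>

lemma choice_optimal:
  assumes "\<And>j. j < n \<Longrightarrow> \<psi> j < m"
  shows "obj choice \<le> obj \<psi>"
  using opt_eq_obj[of choice] opt_le_obj[OF assms] by (simp add: path_choice choice_def)

end

section \<open>Correctness and running time of the program\<close>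

text \<open>Exponent of a common bound for all cells, with \<open>N\<close> the input size. It is
  dictated by the table entries: number of rounds times the largest cost of one placement. The
  summand \<open>m\<close> covers machine numbers.\<close>

definition mem_bits :: "nat \<Rightarrow> nat \<Rightarrow> nat \<Rightarrow> nat" where
  "mem_bits m K N = N * N + 4 * N + (N + 1) * (m * K) + m * K + m + 2"

locale stc_run = stc_dp +
  fixes N :: nat
  assumes inp_le: "\<And>i. inp i \<le> 2 ^ N" and n_le: "n \<le> N" and inp_0: "inp 0 = n"
    and D_eq: "D = (\<Prod>j<n. inp (4 + 2 * j))"
begin

abbreviation L :: nat where "L \<equiv> mem_bits m K N"

text \<open>Every state reached has this shape: array 0 is never overwritten, and all cells beyond
  the listed ones stay 0.\<close>

definition st ::
    "nat \<Rightarrow> nat \<Rightarrow> nat \<Rightarrow> nat \<Rightarrow> nat \<Rightarrow> nat \<Rightarrow> nat \<Rightarrow> (nat \<Rightarrow> nat) \<Rightarrow> (nat \<Rightarrow> nat) \<Rightarrow> state" where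
  "st r0 r1 r2 r3 r4 r5 r6 a1 a2 =
     \<lparr>reg = (\<lambda>_. 0)(0 := r0, 1 := r1, 2 := r2, 3 := r3, 4 := r4, 5 := r5, 6 := r6),
      arr = (\<lambda>_ _. 0)(0 := inp, 1 := a1, 2 := a2)\<rparr>"

lemma reg_st [simp]:
  "reg (st r0 r1 r2 r3 r4 r5 r6 a1 a2) 0 = r0"
  "reg (st r0 r1 r2 r3 r4 r5 r6 a1 a2) (Suc 0) = r1"
  "reg (st r0 r1 r2 r3 r4 r5 r6 a1 a2) 2 = r2"
  "reg (st r0 r1 r2 r3 r4 r5 r6 a1 a2) 3 = r3"
  "reg (st r0 r1 r2 r3 r4 r5 r6 a1 a2) 4 = r4"
  "reg (st r0 r1 r2 r3 r4 r5 r6 a1 a2) 5 = r5"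
  "reg (st r0 r1 r2 r3 r4 r5 r6 a1 a2) 6 = r6"
  by (simp_all add: st_def)

lemma arr_st [simp]:
  "arr (st r0 r1 r2 r3 r4 r5 r6 a1 a2) 0 = inp"
  "arr (st r0 r1 r2 r3 r4 r5 r6 a1 a2) (Suc 0) = a1"
  "arr (st r0 r1 r2 r3 r4 r5 r6 a1 a2) 2 = a2"
  by (simp_all add: st_def)

lemma reg_update_st:
  fixes r0 r1 r2 r3 r4 r5 r6 :: nat and a1 a2 :: "nat \<Rightarrow> nat"
  defines "s \<equiv> st r0 r1 r2 r3 r4 r5 r6 a1 a2"
  shows "s\<lparr>reg := (reg s)(0 := v)\<rparr> = st v r1 r2 r3 r4 r5 r6 a1 a2"
    "s\<lparr>reg := (reg s)(1 := v)\<rparr> = st r0 v r2 r3 r4 r5 r6 a1 a2"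
    "s\<lparr>reg := (reg s)(2 := v)\<rparr> = st r0 r1 v r3 r4 r5 r6 a1 a2"
    "s\<lparr>reg := (reg s)(3 := v)\<rparr> = st r0 r1 r2 v r4 r5 r6 a1 a2"
    "s\<lparr>reg := (reg s)(4 := v)\<rparr> = st r0 r1 r2 r3 v r5 r6 a1 a2"
    "s\<lparr>reg := (reg s)(5 := v)\<rparr> = st r0 r1 r2 r3 r4 v r6 a1 a2"
    "s\<lparr>reg := (reg s)(6 := v)\<rparr> = st r0 r1 r2 r3 r4 r5 v a1 a2"
  by (auto simp: s_def st_def fun_eq_iff)

lemma arr_update_st:
  fixes r0 r1 r2 r3 r4 r5 r6 :: nat and a1 a2 :: "nat \<Rightarrow> nat"
  defines "s \<equiv> st r0 r1 r2 r3 r4 r5 r6 a1 a2"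
  shows "s\<lparr>arr := (arr s)(1 := f)\<rparr> = st r0 r1 r2 r3 r4 r5 r6 f a2"
    "s\<lparr>arr := (arr s)(2 := f)\<rparr> = st r0 r1 r2 r3 r4 r5 r6 a1 f"
  by (auto simp: s_def st_def fun_eq_iff)

lemmas update_st = reg_update_st arr_update_st

section \<open>Size bounds for the memory cells\<close>

lemma power_le_bound: "(x::nat) \<le> 2 ^ a \<Longrightarrow> a \<le> L \<Longrightarrow> x \<le> 2 ^ L"
  by (meson le_trans one_le_numeral power_increasing)

lemma le_bound_n: "x \<le> n \<Longrightarrow> x \<le> 2 ^ L"
  by (rule power_le_bound[of _ N]) (use n_le in \<open>auto simp: mem_bits_def intro: le_trans less_imp_le\<close>)

lemma le_bound_m: "x \<le> m \<Longrightarrow> x \<le> 2 ^ L"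
  by (rule power_le_bound[of _ m]) (auto simp: mem_bits_def intro: le_trans less_imp_le)

lemma inp_le_bound: "inp i \<le> 2 ^ L"
  by (rule power_le_bound[OF inp_le]) (simp add: mem_bits_def)

lemma partial_prod_le:
  assumes "i \<le> n"
  shows "(\<Prod>j<i. inp (4 + 2 * j)) \<le> 2 ^ (N * N)"
proof -
  have "(\<Prod>j<i. inp (4 + 2 * j)) \<le> (\<Prod>j<i. 2 ^ N)"
    by (intro prod_mono) (simp add: inp_le)
  also have "\<dots> = 2 ^ (N * i)" by (simp add: power_mult)
  also have "\<dots> \<le> 2 ^ (N * N)"
    using assms n_le by (intro power_increasing mult_le_mono) auto
  finally show ?thesis .
qed

lemma D_le: "D \<le> 2 ^ (N * N)"
  unfolding D_eq by (rule partial_prod_le) simp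

lemma base_le: "base \<le> 2 ^ (N + 1)"
proof -
  have "N + 2 \<le> 2 ^ (N + 1)" by (induction N) auto
  then show ?thesis using n_le by (simp add: base_def)
qed

lemma tsize_le: "tsize \<le> 2 ^ ((N + 1) * (m * K))"
  unfolding tsize_def power_mult using base_le by (intro power_mono) auto

lemma index_le:
  assumes "q \<le> (n + 1) * tsize"
  shows "q \<le> 2 ^ (N + 1 + (N + 1) * (m * K))"
proof -
  have "n + 1 \<le> 2 ^ (N + 1)" using base_le by (simp add: base_def)
  then have "(n + 1) * tsize \<le> 2 ^ (N + 1) * 2 ^ ((N + 1) * (m * K))"
    using tsize_le by (intro mult_le_mono)
  then show ?thesis using assms by (simp add: power_add)
qed

text \<open>Input cells are at most \<open>2 ^ N\<close> and digits are below \<open>base\<close>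
  for every \<open>q\<close>, so that junk indices are covered too.\<close>

lemma pos_le: "pos q i \<le> 2 ^ (m * K + (N + (N + 1)))"
proof -
  have "pos q i \<le> (\<Sum>d<m * K. 2 ^ N * 2 ^ (N + 1))"
    unfolding pos_def
  proof (rule sum_mono)
    fix d
    have "q div base ^ d mod base + 1 \<le> 2 ^ (N + 1)"
      using base_gt_1 base_le by (metis Suc_eq_plus1 Suc_leI le_trans mod_less_divisor
          not_less_iff_gr_or_eq less_trans zero_less_one)
    then have "mem (d mod K) (job q) * (q div base ^ d mod base + 1) \<le> 2 ^ N * 2 ^ (N + 1)"
      unfolding mem_def by (intro mult_le_mono inp_le)
    then show "(if d div K = i then mem (d mod K) (job q) * (q div base ^ d mod base + 1) else 0)
        \<le> 2 ^ N * 2 ^ (N + 1)"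
      by (cases "d div K = i") (simp_all only: if_True if_False zero_le simp_thms)
  qed
  also have "\<dots> = m * K * 2 ^ (N + (N + 1))" by (simp add: power_add)
  also have "\<dots> \<le> 2 ^ (m * K) * 2 ^ (N + (N + 1))"
    by (intro mult_right_mono) (auto simp: less_imp_le)
  finally show ?thesis by (simp add: power_add)
qed

lemma wt_le: "wt j \<le> 2 ^ (N + N * N)"
proof -
  have "D div x \<le> 2 ^ (N * N)" for x using D_le div_le_dividend le_trans by blast
  then show ?thesis unfolding wt_def power_add by (intro mult_le_mono inp_le)
qed

text \<open>A round adds one bounded cost to one older entry, so entries grow only linearly in the
  number of rounds.\<close>

lemma table_le: "table t p \<le> t * 2 ^ (N + N * N + (m * K + (N + (N + 1))))"
proof (induction t arbitrary: p)
  case (Suc t)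
  have "key (table t) q i \<le> Suc t * 2 ^ (N + N * N + (m * K + (N + (N + 1))))" for q i
    using mult_le_mono[OF wt_le[of "job q"] pos_le[of q i]] Suc[of "nxt q i"]
    unfolding key_def power_add[symmetric] by simp
  then show ?case using Suc[of p] by (simp add: le_SucI trans_le_add2)
qed simp

lemma table_le_bound:
  assumes "t \<le> n * tsize"
  shows "table t p \<le> 2 ^ L"
proof -
  have "t \<le> 2 ^ N * 2 ^ ((N + 1) * (m * K))"
    using assms mult_le_mono[OF _ tsize_le, of n "2 ^ N"] n_le less_imp_le[OF less_exp[of N]]
    by (meson le_trans)
  then have "table t p \<le> 2 ^ N * 2 ^ ((N + 1) * (m * K)) * 2 ^ (N + N * N + (m * K + (N + (N + 1))))"
    using table_le[of t p] by (meson le_trans mult_le_mono1)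
  also have "\<dots> = 2 ^ (N + (N + 1) * (m * K) + (N + N * N + (m * K + (N + (N + 1)))))"
    by (simp only: power_add)
  finally show ?thesis by (rule power_le_bound) (simp add: mem_bits_def)
qed

text \<open>Register 0 is bounded by \<open>N\<close> instead of \<open>n\<close> because it starts
  with the length of the input.\<close>

lemma bounded_st:
  assumes "r0 \<le> N" "r1 \<le> n" "r2 \<le> 2 ^ (N * N)" "r3 \<le> n" "r4 \<le> base" "r5 \<le> tsize"
    "r6 \<le> (n + 1) * tsize" "\<And>p. a1 p \<le> m" "\<And>p. a2 p \<le> 2 ^ L"
  shows "bounded L (st r0 r1 r2 r3 r4 r5 r6 a1 a2)"
proof -
  have "r0 \<le> 2 ^ L"
    by (rule power_le_bound[of _ N])
      (use assms(1) in \<open>auto simp: mem_bits_def intro: le_trans less_imp_le\<close>)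
  moreover have "r2 \<le> 2 ^ L"
    by (rule power_le_bound[OF assms(3)]) (simp add: mem_bits_def)
  moreover have "r4 \<le> 2 ^ L"
    by (rule power_le_bound[OF le_trans[OF assms(5) base_le]]) (simp add: mem_bits_def)
  moreover have "r5 \<le> 2 ^ L"
    by (rule power_le_bound[OF le_trans[OF assms(6) tsize_le]]) (simp add: mem_bits_def)
  moreover have "r6 \<le> 2 ^ L"
    by (rule power_le_bound[OF index_le[OF assms(7)]]) (simp add: mem_bits_def)
  moreover have "0 < L" by (simp add: mem_bits_def)
  ultimately show ?thesis
    using assms(9) le_bound_n[OF assms(2)] le_bound_n[OF assms(4)] le_bound_m[OF assms(8)]
      inp_le_bound
    by (simp add: bounded_def st_def)
qed

section \<open>Values of the expressions in program states\<close>

lemma val_jobE [simp]: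
  "val jobE (st n r1 D r3 base tsize q a1 a2) = job q"
  by (simp add: jobE_def job_def)

lemma val_weightE [simp]:
  "val weightE (st n r1 D r3 base tsize q a1 a2) = wt (job q)"
  by (simp add: weightE_def wt_def)

lemma val_memberE [simp]:
  "val (memberE k) (st n r1 D r3 base tsize q a1 a2) = mem k (job q)"
  by (simp add: memberE_def mem_def)

lemma val_digitE [simp]:
  "val (digitE d) (st n r1 D r3 base tsize q a1 a2) = q div base ^ d mod base"
  by (simp add: digitE_def minus_mult_div_eq_mod)

lemma val_posE [simp]:
  "val (posE m K i) (st n r1 D r3 base tsize q a1 a2) = pos q i"
  unfolding posE_def pos_def by (auto intro!: sum.cong)

lemma val_nextE [simp]:
  "val (nextE m K i) (st n r1 D r3 base tsize q a1 a2) = nxt q i"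
  unfolding nextE_def nxt_def by (auto intro!: sum.cong)

lemma val_keyE [simp]:
  "val (keyE m K i) (st n r1 D r3 base tsize q a1 a2) = key a2 q i"
  by (simp add: keyE_def key_def)

section \<open>Execution of the loops\<close>

lemma runs_denom_loop:
  "runs L denom_loop (st n 0 1 0 0 0 0 (\<lambda>_. 0) (\<lambda>_. 0)) (N * (1 + (1 + 1)) + 1)
     (st n 0 D n 0 0 0 (\<lambda>_. 0) (\<lambda>_. 0))"
proof -
  define \<sigma> where "\<sigma> i = st n 0 (\<Prod>j<i. inp (4 + 2 * j)) i 0 0 0 (\<lambda>_. 0) (\<lambda>_. 0)" for i
  \<comment> \<open>Two indices are needed: between the two assignments of a round, the product is
    one factor ahead of the counter.\<close>
  have bnd: "bounded L (st n 0 (\<Prod>j<i. inp (4 + 2 * j)) i' 0 0 0 (\<lambda>_. 0) (\<lambda>_. 0))"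
    if "i \<le> n" "i' \<le> n" for i i'
    by (rule bounded_st) (use that partial_prod_le n_le in auto)
  have "runs L (Seq (Assign 2 (Times (Reg 2) (Arr 0 (Plus (Const 4) (Times (Const 2) (Reg 3))))))
       (Assign 3 (Plus (Reg 3) (Const 1)))) (\<sigma> i) (1 + 1) (\<sigma> (Suc i))" if "i < n" for i
    unfolding \<sigma>_def
    by (rule runs_Seq[OF runs_Assign runs_Assign], rule bnd)
      (use that bnd[of "Suc i" i] in \<open>auto simp: update_st\<close>)
  then show ?thesis
    unfolding denom_loop_def
    by (rule runs_While[where \<sigma> = \<sigma> and k = n, rotated 2])
      (use bnd n_le in \<open>auto simp: \<sigma>_def D_eq\<close>)
qed

lemma runs_table_loop:
  "runs L (table_loop m K) (st n 0 D n base tsize tsize (\<lambda>_. 0) (\<lambda>_. 0))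
     (N * (N + 2) ^ (m * K) * (1 + (1 + 1)) + 1)
     (st n 0 D n base tsize ((n + 1) * tsize) (\<lambda>_. 0) opt)"
proof -
  define \<sigma> where "\<sigma> t = st n 0 D n base tsize (tsize + t) (\<lambda>_. 0) (table t)" for t
  have bnd: "bounded L (st n 0 D n base tsize (tsize + t') (\<lambda>_. 0) (table t))"
    if "t \<le> n * tsize" "t' \<le> n * tsize" for t t'
    by (rule bounded_st) (use that D_le n_le table_le_bound in auto)
  have step: "runs L (Seq (Store 2 (Reg 6) (minE (keyE m K) (m - 1))) (Assign 6 (Plus (Reg 6) (Const 1))))
      (\<sigma> t) (1 + 1) (\<sigma> (Suc t))" if "t < n * tsize" for t
    unfolding \<sigma>_def
    by (rule runs_Seq[OF runs_Store runs_Assign], rule bnd)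
      (use that bnd[of "Suc t" t] in \<open>auto simp: update_st best_def\<close>)
  have "n * tsize \<le> N * (N + 2) ^ (m * K)"
    unfolding tsize_def base_def using n_le by (intro mult_le_mono power_mono) auto
  then show ?thesis
    unfolding table_loop_def
    by (intro runs_While[where \<sigma> = \<sigma> and k = "n * tsize", OF _ _ step])
      (use bnd in \<open>auto simp: \<sigma>_def\<close>)
qed

text \<open>After the last job the index is below \<open>tsize\<close>, outside the scope of
  \<open>path_range\<close>.\<close>

lemma trace_le:
  assumes "j \<le> n"
  shows "trace j \<le> (n + 1) * tsize"
proof (cases "j < n")
  case True
  then show ?thesis using path_range[of j choice] by (simp add: path_choice)
next
  case False
  then have "trace j div tsize = 0"
    using path_aux(1)[OF path_eq[of n choice]] assms by (simp add: path_choice)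
  then show ?thesis using tsize_pos by (simp add: div_eq_0_iff)
qed

lemma runs_output_loop:
  "runs L (output_loop m K) (st n 0 D n base tsize (n * tsize) (\<lambda>_. 0) opt)
     (N * (1 + (1 + (1 + 1))) + 1)
     (st n n D n base tsize (trace n) (\<lambda>p. if p < n then Suc (choice p) else 0) opt)"
proof -
  define out where "out j p = (if p < j then Suc (choice p) else 0)" for j p
  define \<sigma> where "\<sigma> j = st n j D n base tsize (trace j) (out j) opt" for j
  have bnd: "bounded L (st n j D n base tsize (trace j') (out i) opt)"
    if "j \<le> n" "j' \<le> n" for j j' i
    by (rule bounded_st)
      (use that D_le n_le table_le_bound trace_le choice_less in \<open>auto simp: out_def Suc_leI\<close>)
  have out_Suc: "(out j)(j := Suc (choice j)) = out (Suc j)" for j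
    by (auto simp: out_def fun_eq_iff)
  have "runs L (Seq (Store 1 (Reg 1) (aminE (keyE m K) (\<lambda>i. Const (Suc i)) (m - 1)))
       (Seq (Assign 6 (aminE (keyE m K) (nextE m K) (m - 1)))
         (Assign 1 (Plus (Reg 1) (Const 1)))))
      (\<sigma> j) (1 + (1 + 1)) (\<sigma> (Suc j))" if j: "j < n" for j
  proof (rule runs_Seq[OF runs_Store runs_Seq[OF runs_Assign runs_Assign]])
    show "bounded L (\<sigma> j)" using bnd j by (simp add: \<sigma>_def)
    show "(\<sigma> j)\<lparr>arr := (arr (\<sigma> j))(1 := (arr (\<sigma> j) 1)(val (Reg 1) (\<sigma> j)
        := val (aminE (keyE m K) (\<lambda>i. Const (Suc i)) (m - 1)) (\<sigma> j)))\<rparr>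
      = st n j D n base tsize (trace j) (out (Suc j)) opt"
      using out_Suc[of j] by (simp add: \<sigma>_def arr_update_st[simplified] choice_def best_def)
    show "bounded L (st n j D n base tsize (trace j) (out (Suc j)) opt)"
      using bnd j by simp
    show "bounded L (st n j D n base tsize (trace (Suc j)) (out (Suc j)) opt)"
      using bnd j by (meson Suc_leI less_imp_le)
  qed (simp_all add: \<sigma>_def reg_update_st[simplified] best_def)
  then show ?thesis
    unfolding output_loop_def
    by (rule runs_While[where \<sigma> = \<sigma> and k = n, rotated 2])
      (use bnd n_le in \<open>auto simp: \<sigma>_def out_def[abs_def]\<close>)
qed

lemma runs_stc_prog:
  assumes "l \<le> N"
  shows "runs L (stc_prog m K) (st l 0 0 0 0 0 0 (\<lambda>_. 0) (\<lambda>_. 0))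
     (9 + 7 * N + 3 * (N * (N + 2) ^ (m * K)))
     (st n n D n base tsize (trace n) (\<lambda>p. if p < n then Suc (choice p) else 0) opt)"
proof -
  let ?z = "\<lambda>_::nat. 0::nat"
  have bnd: "bounded L (st r0 0 r2 r3 r4 r5 r6 ?z a)"
    if "r0 \<le> N" "r2 = 0 \<or> r2 = 1 \<or> r2 = D" "r3 \<le> n" "r4 \<le> base" "r5 \<le> tsize"
      "r6 \<le> (n + 1) * tsize" "a = ?z \<or> a = opt" for r0 r2 r3 r4 r5 r6 a
    by (rule bounded_st) (use that D_le table_le_bound in auto)
  have a1: "runs L (Assign 0 (Arr 0 (Const 0))) (st l 0 0 0 0 0 0 ?z ?z) 1 (st n 0 0 0 0 0 0 ?z ?z)"
    by (rule runs_Assign[OF bnd]) (use assms in \<open>auto simp: update_st inp_0\<close>)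
  have a2: "runs L (Assign 2 (Const 1)) (st n 0 0 0 0 0 0 ?z ?z) 1 (st n 0 1 0 0 0 0 ?z ?z)"
    by (rule runs_Assign[OF bnd]) (use n_le in \<open>auto simp: update_st\<close>)
  have a3: "runs L (Assign 4 (Plus (Reg 0) (Const 2))) (st n 0 D n 0 0 0 ?z ?z) 1
      (st n 0 D n base 0 0 ?z ?z)"
    by (rule runs_Assign[OF bnd]) (use n_le in \<open>auto simp: update_st base_def\<close>)
  have a4: "runs L (Assign 5 (powE (Reg 4) (m * K))) (st n 0 D n base 0 0 ?z ?z) 1
      (st n 0 D n base tsize 0 ?z ?z)"
    by (rule runs_Assign[OF bnd]) (use n_le in \<open>auto simp: update_st tsize_def\<close>)
  have a5: "runs L (Assign 6 (Reg 5)) (st n 0 D n base tsize 0 ?z ?z) 1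
      (st n 0 D n base tsize tsize ?z ?z)"
    by (rule runs_Assign[OF bnd]) (use n_le in \<open>auto simp: update_st\<close>)
  have a6: "runs L (Assign 6 (Times (Reg 0) (Reg 5)))
      (st n 0 D n base tsize ((n + 1) * tsize) ?z opt) 1 (st n 0 D n base tsize (n * tsize) ?z opt)"
    by (rule runs_Assign[OF bnd]) (use n_le in \<open>auto simp: update_st\<close>)
  \<comment> \<open>Six single assignments and three failing tests make 9; a round takes 3 steps for
    a denominator, 4 for an output entry and 3 for a table entry.\<close>
  have steps: "9 + 7 * N + 3 * (N * (N + 2) ^ (m * K))
      = 1 + (1 + ((N * (1 + (1 + 1)) + 1) + (1 + (1 + (1
       + ((N * (N + 2) ^ (m * K) * (1 + (1 + 1)) + 1) + (1 + (N * (1 + (1 + (1 + 1))) + 1))))))))"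
    by simp
  show ?thesis
    unfolding stc_prog_def steps
    by (rule runs_Seq[OF a1 runs_Seq[OF a2 runs_Seq[OF runs_denom_loop runs_Seq[OF a3
        runs_Seq[OF a4 runs_Seq[OF a5 runs_Seq[OF runs_table_loop
        runs_Seq[OF a6 runs_output_loop]]]]]]]])
qed

end

section \<open>Encoded instances\<close>

lemma nth_concat_uniform:
  assumes "\<And>xs. xs \<in> set xss \<Longrightarrow> length xs = c" "i < length xss" "j < c"
  shows "concat xss ! (i * c + j) = xss ! i ! j"
  using assms
proof (induction xss arbitrary: i)
  case (Cons xs xss)
  then show ?case by (cases i) (auto simp: nth_append)
qed simp

lemma length_concat_uniform:
  "(\<And>xs. xs \<in> set xss \<Longrightarrow> length xs = c) \<Longrightarrow> length (concat xss) = length xss * c"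
  by (induction xss) auto

definition frac_list :: "stc_instance \<Rightarrow> nat list" where
  "frac_list I = concat (map (\<lambda>j. [nat (fst (quotient_of (weight I j))),
     nat (snd (quotient_of (weight I j)))]) [1..<Suc (num_jobs I)])"

definition member_list :: "stc_instance \<Rightarrow> nat list" where
  "member_list I = concat (map (\<lambda>k. map (\<lambda>j. of_bool (j \<in> scenario I k)) [1..<Suc (num_jobs I)])
     [1..<Suc (num_scenarios I)])"

lemma encode_eq:
  "encode I = [num_jobs I, num_machines I, num_scenarios I] @ frac_list I @ member_list I"
  by (simp add: encode_def frac_list_def member_list_def)

lemma length_frac_list: "length (frac_list I) = num_jobs I * 2"
  unfolding frac_list_def by (subst length_concat_uniform[of _ 2]) auto

lemma length_member_list: "length (member_list I) = num_scenarios I * num_jobs I"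
  unfolding member_list_def by (subst length_concat_uniform[of _ "num_jobs I"]) auto

lemma encode_frac:
  assumes "j < num_jobs I"
  shows "encode I ! (3 + 2 * j) = nat (fst (quotient_of (weight I (Suc j))))"
    and "encode I ! (4 + 2 * j) = nat (snd (quotient_of (weight I (Suc j))))"
proof -
  have "frac_list I ! (j * 2 + i) = [nat (fst (quotient_of (weight I (Suc j)))),
     nat (snd (quotient_of (weight I (Suc j))))] ! i" if "i < 2" for i
    unfolding frac_list_def
    by (subst nth_concat_uniform) (use assms that in \<open>auto simp del: upt_Suc\<close>)
  from this[of 0] this[of 1] show
    "encode I ! (3 + 2 * j) = nat (fst (quotient_of (weight I (Suc j))))"
    "encode I ! (4 + 2 * j) = nat (snd (quotient_of (weight I (Suc j))))"
    using assms
    by (simp_all add: encode_eq nth_append length_frac_list nth_Cons' mult.commute)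
qed

text \<open>The second claim keeps the cell within the list, outside of which \<open>entry\<close>
  defaults to 0.\<close>

lemma encode_member:
  assumes "j < num_jobs I" "k < num_scenarios I"
  shows "encode I ! (3 + (k + 2) * num_jobs I + j) = of_bool (Suc j \<in> scenario I (Suc k))"
    and "3 + (k + 2) * num_jobs I + j < length (encode I)"
proof -
  have *: "k * num_jobs I + j < num_scenarios I * num_jobs I"
  proof -
    have "k * num_jobs I + j < Suc k * num_jobs I" using assms(1) by simp
    also have "\<dots> \<le> num_scenarios I * num_jobs I" using assms(2) by (intro mult_le_mono1) simp
    finally show ?thesis .
  qed
  then show "3 + (k + 2) * num_jobs I + j < length (encode I)"
    by (simp add: encode_eq length_frac_list length_member_list algebra_simps)
  have "member_list I ! (k * num_jobs I + j) = of_bool (Suc j \<in> scenario I (Suc k))"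
    unfolding member_list_def
    by (subst nth_concat_uniform) (use assms in \<open>auto simp del: upt_Suc\<close>)
  moreover have "encode I ! (3 + (k + 2) * num_jobs I + j)
      = (frac_list I @ member_list I) ! (num_jobs I * 2 + (k * num_jobs I + j))"
  proof -
    have "3 + (k + 2) * num_jobs I + j
        = length [num_jobs I, num_machines I, num_scenarios I]
          + (num_jobs I * 2 + (k * num_jobs I + j))"
      by (simp add: algebra_simps)
    then show ?thesis unfolding encode_eq by (simp only: nth_append_length_plus)
  qed
  ultimately show "encode I ! (3 + (k + 2) * num_jobs I + j) = of_bool (Suc j \<in> scenario I (Suc k))"
    by (simp only: length_frac_list[symmetric] nth_append_length_plus)
qed

text \<open>Every number, even 0, has at least one digit.\<close>

lemma length_le_input_size: "length xs \<le> input_size xs"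
  by (induction xs) (auto simp: input_size_def len_def)

lemma nth_le_input_size:
  assumes "i < length xs"
  shows "xs ! i \<le> 2 ^ input_size xs"
proof -
  have "len (xs ! i) \<le> input_size xs"
    unfolding input_size_def using assms by (intro member_le_sum_list) auto
  then show ?thesis
    using le_power_len[of "xs ! i"] by (meson le_trans one_le_numeral power_increasing)
qed

definition entry :: "nat list \<Rightarrow> nat \<Rightarrow> nat" where
  "entry xs i = (if i < length xs then xs ! i else 0)"

lemma stc_run_instance:
  fixes I :: stc_instance
  defines "f \<equiv> entry (encode I)"
  assumes "1 \<le> num_machines I"
  shows "stc_run f (num_jobs I) (num_machines I) (num_scenarios I)
    (\<Prod>j<num_jobs I. f (4 + 2 * j)) (input_size (encode I))"
proof
  show "1 \<le> num_machines I" by fact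
  show "f (3 + (k + 2) * num_jobs I + j) \<le> 1" if "k < num_scenarios I" "j < num_jobs I" for k j
    using encode_member[OF that(2,1)] by (simp add: f_def entry_def)
  show "f i \<le> 2 ^ input_size (encode I)" for i
    using nth_le_input_size by (simp add: f_def entry_def)
  have "num_jobs I \<le> length (encode I)" by (simp add: encode_eq length_frac_list)
  then show "num_jobs I \<le> input_size (encode I)"
    using length_le_input_size le_trans by blast
  show "f 0 = num_jobs I" by (simp add: f_def entry_def encode_eq)
qed simp

text \<open>Regroups the cost by job and counts from 0, as in \<open>obj\<close>: a position is 1
  plus the number of earlier jobs of the scenario on the same machine.\<close>

lemma stc_cost_shifted:
  fixes \<phi> :: "nat \<Rightarrow> nat"
  assumes \<phi>: "\<And>j. j < num_jobs I \<Longrightarrow> \<phi> j < num_machines I"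
    and \<psi>: "\<And>j. j < num_jobs I \<Longrightarrow> \<psi> (Suc j) = Suc (\<phi> j)"
  defines "b \<equiv> \<lambda>k j. of_bool (Suc j \<in> scenario I (Suc k)) :: nat"
  shows "total_cost I \<psi> = (\<Sum>j<num_jobs I. weight I (Suc j) * of_nat
    (\<Sum>k<num_scenarios I. b k j * ((\<Sum>l<j. if \<phi> l = \<phi> j then b k l else 0) + 1)))"
proof -
  let ?n = "num_jobs I" and ?S = "\<lambda>k. scenario I k"
  have card: "card {j' \<in> jobs_on I \<psi> (\<psi> (Suc j)) \<inter> ?S (Suc k). j' \<le> Suc j}
      = (\<Sum>l<j. if \<phi> l = \<phi> j then b k l else 0) + 1"
    if "j < ?n" "Suc j \<in> ?S (Suc k)" for j k
  proof -
    have "{j' \<in> jobs_on I \<psi> (\<psi> (Suc j)) \<inter> ?S (Suc k). j' \<le> Suc j}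
        = Suc ` {l \<in> {..<Suc j}. \<phi> l = \<phi> j \<and> Suc l \<in> ?S (Suc k)}"
      (is "?A = Suc ` ?B")
    proof (intro equalityI subsetI)
      fix x assume x: "x \<in> ?A"
      then obtain l where "x = Suc l" by (cases x) (auto simp: jobs_on_def)
      then show "x \<in> Suc ` ?B" using x that \<psi> by (auto simp: jobs_on_def)
    next
      fix x assume "x \<in> Suc ` ?B"
      then show "x \<in> ?A" using that \<psi> by (auto simp: jobs_on_def)
    qed
    then have "card ?A = card ?B" by (simp add: card_image)
    also have "\<dots> = (\<Sum>l\<in>{..<Suc j}. if \<phi> l = \<phi> j \<and> Suc l \<in> ?S (Suc k) then 1 else 0)"
      by (simp only: card_eq_sum sum.inter_filter finite_lessThan)
    \<comment> \<open>The term \<open>l = j\<close> always counts and yields the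
      \<open>+ 1\<close>.\<close>
    also have "\<dots> = (\<Sum>l<j. if \<phi> l = \<phi> j then b k l else 0) + 1"
      using that(2) by (auto simp: b_def intro!: sum.cong)
    finally show ?thesis .
  qed
  have "scenario_cost I \<psi> (Suc k) = (\<Sum>j<?n. weight I (Suc j) * of_nat
      (b k j * ((\<Sum>l<j. if \<phi> l = \<phi> j then b k l else 0) + 1)))"
    if "k < num_scenarios I" for k
  proof -
    let ?g = "\<lambda>j. weight I j *
      of_nat (card {j' \<in> jobs_on I \<psi> (\<psi> j) \<inter> ?S (Suc k). j' \<le> j})"
    have "\<psi> j \<in> {1..num_machines I}" if "j \<in> {1..?n}" for j
      using \<psi>[of "j - 1"] \<phi>[of "j - 1"] that by (cases j) (auto simp: Suc_le_eq)
    then have range: "\<psi> ` ({1..?n} \<inter> ?S (Suc k)) \<subseteq> {1..num_machines I}" by blast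
    have "scenario_cost I \<psi> (Suc k)
        = (\<Sum>i = 1..num_machines I. \<Sum>j | j \<in> {1..?n} \<inter> ?S (Suc k) \<and> \<psi> j = i. ?g j)"
      unfolding scenario_cost_def by (intro sum.cong) (auto simp: jobs_on_def)
    \<comment> \<open>Every job lies on exactly one machine in range, so the grouping by machine
      collapses.\<close>
    also have "\<dots> = sum ?g ({1..?n} \<inter> ?S (Suc k))"
      using range by (intro sum.group) auto
    also have "\<dots> = (\<Sum>j = 1..?n. if j \<in> ?S (Suc k) then ?g j else 0)"
      by (rule sum.inter_restrict) simp
    also have "\<dots> = (\<Sum>j<?n. if Suc j \<in> ?S (Suc k) then ?g (Suc j) else 0)"
      by (simp only: sum.atLeast1_atMost_eq One_nat_def)
    also have "\<dots> = (\<Sum>j<?n. weight I (Suc j) * of_nat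
        (b k j * ((\<Sum>l<j. if \<phi> l = \<phi> j then b k l else 0) + 1)))"
    proof (rule sum.cong[OF refl])
      fix j assume "j \<in> {..<?n}"
      then have j: "j < ?n" by simp
      show "(if Suc j \<in> ?S (Suc k) then ?g (Suc j) else 0) = weight I (Suc j) * of_nat
          (b k j * ((\<Sum>l<j. if \<phi> l = \<phi> j then b k l else 0) + 1))"
      proof (cases "Suc j \<in> ?S (Suc k)")
        case True
        show ?thesis unfolding card[OF j True] using True by (simp add: b_def)
      qed (simp add: b_def)
    qed
    finally show ?thesis .
  qed
  then have "total_cost I \<psi> = (\<Sum>k<num_scenarios I. \<Sum>j<?n. weight I (Suc j) * of_nat
      (b k j * ((\<Sum>l<j. if \<phi> l = \<phi> j then b k l else 0) + 1)))"
    unfolding total_cost_def One_nat_def sum.atLeast1_atMost_eq by simp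
  also have "\<dots> = (\<Sum>j<?n. \<Sum>k<num_scenarios I. weight I (Suc j) * of_nat
      (b k j * ((\<Sum>l<j. if \<phi> l = \<phi> j then b k l else 0) + 1)))"
    by (rule sum.swap)
  finally show ?thesis by (simp only: sum_distrib_left of_nat_sum)
qed

text \<open>Each denominator divides \<open>D\<close>, so the division is exact; validity makes
  numerators non-negative, so \<open>nat\<close> preserves them.\<close>

lemma scaled_weight:
  fixes f :: "nat \<Rightarrow> nat" and I :: stc_instance
  defines "f \<equiv> entry (encode I)" and "D \<equiv> (\<Prod>j<num_jobs I. entry (encode I) (4 + 2 * j))"
  assumes "stc_valid I" "j < num_jobs I"
  shows "of_nat (f (3 + 2 * j) * (D div f (4 + 2 * j))) = of_nat D * weight I (Suc j)"
    and "0 < D"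
proof -
  have len: "length (encode I) = 3 + num_jobs I * 2 + num_scenarios I * num_jobs I"
    by (simp add: encode_eq length_frac_list length_member_list)
  have den: "f (4 + 2 * l) = nat (snd (quotient_of (weight I (Suc l))))"
    and num: "f (3 + 2 * l) = nat (fst (quotient_of (weight I (Suc l))))"
    if "l < num_jobs I" for l
    using encode_frac[OF that] that by (simp_all add: f_def entry_def len)
  have den_pos: "0 < f (4 + 2 * l)" if "l < num_jobs I" for l
    using den[OF that] quotient_of_denom_pos' by simp
  then show "0 < D" unfolding D_def f_def[symmetric] by (intro prod_pos) simp
  have "f (4 + 2 * j) dvd D"
    unfolding D_def f_def by (rule dvd_prodI) (use assms(4) in auto)
  then obtain c where c: "D = f (4 + 2 * j) * c" by blast
  obtain a d where ad: "quotient_of (weight I (Suc j)) = (a, d)" by fastforce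
  have w: "weight I (Suc j) = of_int a / of_int d" using quotient_of_div[OF ad] .
  have d: "0 < d" using quotient_of_denom_pos[OF ad] .
  have "0 \<le> weight I (Suc j)" using assms(3,4) by (auto simp: stc_valid_def)
  then have a: "0 \<le> a" using w d by (simp add: zero_le_divide_iff)
  have "of_nat D = (of_int d * of_nat c :: rat)"
    using c den[OF assms(4)] ad d by simp
  then have "of_nat D * weight I (Suc j) = (of_nat (nat a) * of_nat c :: rat)"
    unfolding w using a d by simp
  moreover have "f (3 + 2 * j) * (D div f (4 + 2 * j)) = nat a * c"
    using den_pos[OF assms(4)] num[OF assms(4)] ad c by simp
  ultimately show "of_nat (f (3 + 2 * j) * (D div f (4 + 2 * j))) = of_nat D * weight I (Suc j)"
    by simp
qed

text \<open>Scaling by the positive \<open>D\<close> turns \<open>total_cost\<close> into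
  \<open>obj\<close>, so optimality carries over from \<open>choice_optimal\<close>.\<close>

lemma stc_optimality:
  fixes f :: "nat \<Rightarrow> nat" and I :: stc_instance
  defines "f \<equiv> entry (encode I)" and "n \<equiv> num_jobs I" and "m \<equiv> num_machines I"
    and "K \<equiv> num_scenarios I"
    and "D \<equiv> (\<Prod>j<num_jobs I. entry (encode I) (4 + 2 * j))"
  assumes valid: "stc_valid I" and "1 \<le> num_machines I"
  shows "MinAvgSTC_solution I (map (\<lambda>p. Suc (stc_dp.choice f n m K D p)) [0..<n])"
proof -
  interpret stc_run f n m K D "input_size (encode I)"
    unfolding f_def n_def m_def K_def D_def by (rule stc_run_instance) fact
  \<comment> \<open>\<open>scaled_weight\<close> speaks about a given job; the case without jobs is
    treated separately, all costs being 0 there.\<close>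
  have D_pos: "0 < D" if "0 < n"
    using scaled_weight(2)[OF valid] that unfolding D_def n_def by blast
  have cost: "of_nat D * total_cost I \<psi> = of_nat (obj \<phi>)"
    if "\<And>j. j < n \<Longrightarrow> \<phi> j < m" "\<And>j. j < n \<Longrightarrow> \<psi> (Suc j) = Suc (\<phi> j)" for \<phi> \<psi>
  proof -
    have mem: "mem k j = of_bool (Suc j \<in> scenario I (Suc k))" if "j < n" "k < K" for j k
      using encode_member[of j I k] that
      unfolding mem_def unfolding f_def n_def K_def entry_def by simp
    have wt: "of_nat (wt j) = of_nat D * weight I (Suc j)" if "j < n" for j
      using scaled_weight(1)[OF valid] that unfolding wt_def unfolding f_def D_def n_def by blast
    have occ: "(\<Sum>k<K. of_bool (Suc j \<in> scenario I (Suc k))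
          * ((\<Sum>l<j. if \<phi> l = \<phi> j then of_bool (Suc l \<in> scenario I (Suc k)) else 0) + 1))
        = (\<Sum>k<K. mem k j * (occ \<phi> j (\<phi> j) k + 1))" if "j < n" for j
      using that by (auto simp: mem occ_def intro!: sum.cong)
    have "total_cost I \<psi> = (\<Sum>j<n. weight I (Suc j) * of_nat
        (\<Sum>k<K. of_bool (Suc j \<in> scenario I (Suc k))
          * ((\<Sum>l<j. if \<phi> l = \<phi> j then of_bool (Suc l \<in> scenario I (Suc k)) else 0) + 1)))"
      using that unfolding n_def m_def K_def by (intro stc_cost_shifted)
    also have "\<dots> = (\<Sum>j<n. weight I (Suc j) * of_nat
        (\<Sum>k<K. mem k j * (occ \<phi> j (\<phi> j) k + 1)))"
      by (rule sum.cong[OF refl]) (simp only: occ lessThan_iff)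
    finally have "of_nat D * total_cost I \<psi> = (\<Sum>j<n. (of_nat D * weight I (Suc j)) * of_nat
        (\<Sum>k<K. mem k j * (occ \<phi> j (\<phi> j) k + 1)))"
      by (simp only: sum_distrib_left mult.assoc)
    also have "\<dots> = (\<Sum>j<n. of_nat (wt j) * of_nat (\<Sum>k<K. mem k j * (occ \<phi> j (\<phi> j) k + 1)))"
      by (rule sum.cong[OF refl]) (simp only: wt lessThan_iff)
    also have "\<dots> = of_nat (obj \<phi>)" by (simp add: obj_def)
    finally show ?thesis .
  qed
  define \<rho> where "\<rho> = (\<lambda>j. map (\<lambda>p. Suc (choice p)) [0..<n] ! (j - 1))"
  have \<rho>: "\<rho> (Suc j) = Suc (choice j)" if "j < n" for j using that by (simp add: \<rho>_def)
  have "total_cost I \<rho> \<le> total_cost I \<psi>" if \<psi>: "\<psi> \<in> assignments I" for \<psi>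
  proof (cases "n = 0")
    case True
    then show ?thesis by (simp add: total_cost_def scenario_cost_def jobs_on_def n_def)
  next
    case False
    \<comment> \<open>Machines are renumbered from 0; on jobs \<open>\<psi>\<close> is at least 1,
      so nothing is truncated.\<close>
    define \<phi> where "\<phi> j = \<psi> (Suc j) - 1" for j
    have \<psi>_range: "\<psi> (Suc j) \<in> {1..m}" if "j < n" for j
      using \<psi> that by (auto simp: assignments_def n_def m_def Pi_iff)
    then have \<phi>: "\<phi> j < m" "\<psi> (Suc j) = Suc (\<phi> j)" if "j < n" for j
      using that by (force simp: \<phi>_def)+
    have "of_nat (obj choice) \<le> (of_nat (obj \<phi>) :: rat)"
      using choice_optimal \<phi>(1) by simp
    then have "of_nat D * total_cost I \<rho> \<le> of_nat D * total_cost I \<psi>"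
      using cost[of choice \<rho>, OF choice_less \<rho>] cost[of \<phi> \<psi>, OF \<phi>] by simp
    then show ?thesis using D_pos False by simp
  qed
  moreover have "\<rho> \<in> assignments I"
  proof -
    have "\<rho> j \<in> {1..m}" if "j \<in> {1..n}" for j
      using \<rho>[of "j - 1"] choice_less[of "j - 1"] that by auto
    then show ?thesis by (simp add: assignments_def n_def m_def)
  qed
  ultimately show ?thesis
    by (simp add: MinAvgSTC_solution_def MinAvgSTC_optimal_def \<rho>_def n_def)
qed

theorem theorem5:
  fixes m K :: nat
  assumes "m \<ge> 1"
  shows "poly_time_solvable (MinAvgSTC_instances m K) encode MinAvgSTC_solution"
proof -
  \<comment> \<open>The factors are the number of steps, the constant of the program, and
    \<open>mem_bits m K\<close> expanded in powers of the input size.\<close>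
  define p :: "nat poly" where
    "p = ([:9, 7:] + [:0, 3:] * [:2, 1:] ^ (m * K)) * [:prog_factor (stc_prog m K):]
      * [:2 * (m * K) + m + 2, m * K + 4, 1:]"
  have p: "poly p N = (9 + 7 * N + 3 * (N * (N + 2) ^ (m * K))) * prog_factor (stc_prog m K)
      * mem_bits m K N" for N
  proof -
    have "poly [:2 * (m * K) + m + 2, m * K + 4, 1:] N = mem_bits m K N"
      by (simp add: mem_bits_def algebra_simps)
    then show ?thesis
      unfolding p_def poly_mult poly_add poly_power by (simp add: algebra_simps)
  qed
  have "\<exists>t s. exec (stc_prog m K) (initial (encode I)) t s
      \<and> t \<le> poly p (input_size (encode I)) \<and> MinAvgSTC_solution I (result s)"
    if "I \<in> MinAvgSTC_instances m K" for I
  proof -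
    have I: "stc_valid I" "num_machines I = m" "num_scenarios I = K"
      using that by (auto simp: MinAvgSTC_instances_def)
    let ?f = "entry (encode I)" and ?n = "num_jobs I"
    let ?D = "\<Prod>j<?n. ?f (4 + 2 * j)"
    interpret stc_run ?f ?n m K ?D "input_size (encode I)"
      using stc_run_instance[of I] I assms by simp
    have init: "initial (encode I) = st (length (encode I)) 0 0 0 0 0 0 (\<lambda>_. 0) (\<lambda>_. 0)"
      by (auto simp: initial_def st_def entry_def fun_eq_iff)
    let ?s = "st ?n ?n ?D ?n base tsize (trace ?n) (\<lambda>p. if p < ?n then Suc (choice p) else 0) opt"
    obtain t where t: "exec (stc_prog m K) (initial (encode I)) t ?s"
      "t \<le> poly p (input_size (encode I))"
      using runs_stc_prog[OF length_le_input_size] unfolding runs_def init p by blast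
    have "result ?s = map (\<lambda>p. Suc (choice p)) [0..<?n]"
      by (simp add: result_def)
    moreover have "MinAvgSTC_solution I (map (\<lambda>p. Suc (choice p)) [0..<?n])"
      using stc_optimality[OF I(1)] I assms by simp
    ultimately have "MinAvgSTC_solution I (result ?s)" by simp
    with t show ?thesis by blast
  qed
  then show ?thesis unfolding poly_time_solvable_def by blast
qed

end
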